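(* Let $t \geq 3$, $k = t-1$, and $n \geq 2k^2+4k$. Consider the Zeckendorf game on $n$ with $p = tk$ players divided into $t$ teams, where each team consists of exactly $k$ consecutive players. Then no team has a winning strategy.
   Context: Let $F_1=1$, $F_2=2$, $F_{i+1}=F_i+F_{i-1}$. The Zeckendorf game on $n$ starts with the multiset of $n$ copies of $1$. A move is one of: if the list contains $F_{i-1}$ and $F_i$, replace them by $F_{i+1}$; if the list contains two copies of $F_i$: for $i=1$ replace them by $F_2$; for $i=2$ replace them by $F_1,F_3$; for $i\geq 3$ replace them by $F_{i-2},F_{i+1}$. The game ends when the list is the Zeckendorf decomposition of $n$ (distinct, pairwise non-consecutive Fibonacci numbers); every game terminates. With $p$ players, players $1,\dots,p$ move in cyclic order $1,2,\dots,p,1,2,\dots$ starting with player 1; players $i$ and $i+1 \pmod p$ are consecutive (in particular $p$ and $1$ are consecutive). Players are partitioned into teams (alliances); a team wins if the final move (creating the Zeckendorf decomposition) is made by one of its members. A team has a winning strategy if its members can choose their moves so that the final move is made by a member of the team no matter what moves the other players make. *)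

theory Defs
  imports "HOL-Library.Multiset" "HOL-Library.Disjoint_Sets" "HOL-Number_Theory.Fib"
begin

(* The library has fib 1 = fib 2 = 1, hence the shift: zfib 1 = 1, zfib 2 = 2, zfib 3 = 3, ...
   Only indices i \<ge> 1 are meaningful; all uses below are guarded accordingly. *)
definition zfib :: "nat \<Rightarrow> nat" where
  "zfib i = fib (Suc i)"

lemma zfib_1: "zfib 1 = 1"
  by (simp add: zfib_def)

lemma zfib_2: "zfib 2 = 2"
  by (simp add: zfib_def numeral_2_eq_2)

lemma zfib_rec: "i \<ge> 2 \<Longrightarrow> zfib (i + 1) = zfib i + zfib (i - 1)"
  by (cases i) (simp_all add: zfib_def)

(* Positions are multisets of Fibonacci numbers (the numbers themselves, not their indices). *)
inductive zmove :: "nat multiset \<Rightarrow> nat multiset \<Rightarrow> bool" where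
  combine: "i \<ge> 2 \<Longrightarrow> {#zfib (i - 1), zfib i#} \<subseteq># M \<Longrightarrow>
     zmove M (M - {#zfib (i - 1), zfib i#} + {#zfib (i + 1)#})"
| merge_ones: "{#zfib 1, zfib 1#} \<subseteq># M \<Longrightarrow>
     zmove M (M - {#zfib 1, zfib 1#} + {#zfib 2#})"
| split_twos: "{#zfib 2, zfib 2#} \<subseteq># M \<Longrightarrow>
     zmove M (M - {#zfib 2, zfib 2#} + {#zfib 1, zfib 3#})"
| split: "i \<ge> 3 \<Longrightarrow> {#zfib i, zfib i#} \<subseteq># M \<Longrightarrow>
     zmove M (M - {#zfib i, zfib i#} + {#zfib (i - 2), zfib (i + 1)#})"

definition zeckendorf_decomposition :: "nat \<Rightarrow> nat multiset \<Rightarrow> bool" where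
  "zeckendorf_decomposition n M \<longleftrightarrow>
     sum_mset M = n \<and>
     set_mset M \<subseteq> zfib ` {1..} \<and>
     (\<forall>x. count M x \<le> 1) \<and>
     (\<forall>i\<ge>1. \<not> (zfib i \<in># M \<and> zfib (i + 1) \<in># M))"

(* A (possibly unfinished) play is the nonempty list of all positions reached so far;
   move number m (counted from 0) leads from entry m to entry m + 1. *)
definition zplay :: "nat \<Rightarrow> nat multiset list \<Rightarrow> bool" where
  "zplay n h \<longleftrightarrow>
     h \<noteq> [] \<and> hd h = replicate_mset n 1 \<and>
     (\<forall>m. Suc m < length h \<longrightarrow>
        \<not> zeckendorf_decomposition n (h ! m) \<and> zmove (h ! m) (h ! Suc m))"

definition complete_zplay :: "nat \<Rightarrow> nat multiset list \<Rightarrow> bool" where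
  "complete_zplay n h \<longleftrightarrow> zplay n h \<and> zeckendorf_decomposition n (last h)"

(* The player in {1..p} making move number m (counted from 0). *)
definition mover :: "nat \<Rightarrow> nat \<Rightarrow> nat" where
  "mover p m = m mod p + 1"

(* Consecutiveness is cyclic (p is followed by 1): the sets of k consecutive players (k \<le> p)
   are exactly the sets of players making k successive moves. *)
definition consecutive_players :: "nat \<Rightarrow> nat \<Rightarrow> nat set \<Rightarrow> bool" where
  "consecutive_players p k T \<longleftrightarrow> (\<exists>s. T = mover p ` {s..<s + k}) \<and> card T = k"

(* A strategy is joint for the whole team and may depend on the entire history:
   it maps the play so far to the next position. After history h, the number of the
   upcoming move is length h - 1. *)
definition legal_strategy ::
  "nat \<Rightarrow> nat \<Rightarrow> nat set \<Rightarrow> (nat multiset list \<Rightarrow> nat multiset) \<Rightarrow> bool" where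
  "legal_strategy n p T \<sigma> \<longleftrightarrow>
     (\<forall>h. zplay n h \<and> \<not> zeckendorf_decomposition n (last h) \<and> mover p (length h - 1) \<in> T
        \<longrightarrow> zmove (last h) (\<sigma> h))"

definition follows_strategy ::
  "nat \<Rightarrow> nat set \<Rightarrow> (nat multiset list \<Rightarrow> nat multiset) \<Rightarrow> nat multiset list \<Rightarrow> bool" where
  "follows_strategy p T \<sigma> h \<longleftrightarrow>
     (\<forall>m. Suc m < length h \<and> mover p m \<in> T \<longrightarrow> h ! Suc m = \<sigma> (take (Suc m) h))"

(* The last move of h has number length h - 2; length h \<ge> 2 says that a move was made at all.
   Only finite plays are considered because every game terminates. *)
definition won_by :: "nat \<Rightarrow> nat set \<Rightarrow> nat multiset list \<Rightarrow> bool" where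
  "won_by p T h \<longleftrightarrow> length h \<ge> 2 \<and> mover p (length h - 2) \<in> T"

definition has_winning_strategy :: "nat \<Rightarrow> nat \<Rightarrow> nat set \<Rightarrow> bool" where
  "has_winning_strategy n p T \<longleftrightarrow>
     (\<exists>\<sigma>. legal_strategy n p T \<sigma> \<and>
        (\<forall>h. complete_zplay n h \<and> follows_strategy p T \<sigma> h \<longrightarrow> won_by p T h))"

end

theory Submission
  imports Defs
begin

text \<open>
  Strategy stealing against the clock. Suppose a team has a winning strategy and its opponents can
  reach one and the same position after \<open>m\<close> and after \<open>m + d\<close> moves, where \<open>k \<le> d \<le> k\<^sup>2\<close>.
  Shifted by \<open>d\<close>, the turns of the team are disjoint from its own turns (\<open>p = k\<^sup>2 + k\<close>), so the
  strategy can be played against its own shifted copy from that position, and both copies would have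
  to make the last move.

  The opponents have \<open>k\<^sup>2\<close> successive turns for the two routes. A \<open>3\<close> can be made from ones by
  \<open>1+1, 1+2\<close> or by \<open>1+1, 1+1, 2+2\<close>, which gains one move, and a \<open>5\<close> from \<open>1, 1, 3\<close> by \<open>1+1, 2+3\<close> or by
  \<open>1+1, 1+1, 2+2, 3+3\<close>, which gains two. For \<open>k \<ge> 3\<close> this yields \<open>d = k\<close> within \<open>3k - 2\<close> moves, and
  there are enough ones left whatever has been played before. For \<open>k = 2\<close> a block of four turns does
  not suffice from ones alone, and the opponents first use one or two blocks to force a
  position with suitable larger numbers.
\<close>

section \<open>Fibonacci values and single moves\<close>

lemma zfib_pos [simp]: "0 < zfib i"
  by (simp add: zfib_def fib_neq_0_nat)

lemma zfib_strict_mono: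
  assumes "1 \<le> i" "i < j"
  shows "zfib i < zfib j"
  using assms(2,1)
proof (induction rule: strict_inc_induct)
  case (base i)
  then show ?case by (cases i) (auto simp: zfib_def fib_neq_0_nat)
next
  case (step i)
  moreover have "zfib i \<le> zfib (Suc i)" by (simp add: zfib_def)
  ultimately show ?case by simp
qed

lemma zfib_numerals [simp]:
  "zfib (Suc 0) = 1" "zfib 1 = 1" "zfib 2 = 2" "zfib 3 = 3" "zfib 4 = 5" "zfib 5 = 8"
  by (simp_all add: zfib_def eval_nat_numeral)

abbreviation sum_squares :: "nat multiset \<Rightarrow> nat" where
  "sum_squares M \<equiv> (\<Sum>x\<in>#M. x\<^sup>2)"

text \<open>The sum of squares, bounded by \<open>n\<^sup>2\<close>, is the monovariant that makes every play terminate.\<close>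

lemma zmove_decompose:
  assumes "zmove M N"
  obtains A U V where "M = A + U" "N = A + V" "size U = 2" "sum_mset U = sum_mset V"
    "sum_squares U < sum_squares V" "set_mset V \<subseteq> zfib ` {1..}"
proof -
  note decomposed = that
  have *: thesis if "U \<subseteq># M" "N = M - U + V" "size U = 2" "sum_mset U = sum_mset V"
    "sum_squares U < sum_squares V" "set_mset V \<subseteq> zfib ` {1..}" for U V
    using that by (intro decomposed[of "M - U" U V]) auto
  from assms show thesis
  proof cases
    case (combine i)
    have "zfib (i + 1) \<in> zfib ` {1..}" by (rule imageI) simp
    moreover have "zfib (i + 1) = zfib (i - 1) + zfib i" using zfib_rec[OF \<open>i \<ge> 2\<close>] by simp
    moreover have "(zfib (i - 1))\<^sup>2 + (zfib i)\<^sup>2 < (zfib (i - 1) + zfib i)\<^sup>2"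
      by (simp add: power2_sum)
    ultimately show thesis
      by (intro *[OF combine(3,1)]) (simp_all del: One_nat_def)
  next
    case merge_ones
    then show thesis
      by (intro *[OF merge_ones(2,1)]) (auto intro!: image_eqI[of _ _ 2] simp del: One_nat_def)
  next
    case split_twos
    have "{1, 3} \<subseteq> zfib ` {1..}"
      by (auto intro: image_eqI[of _ _ 1] image_eqI[of _ _ 3] simp del: One_nat_def)
    with split_twos show thesis
      by (intro *[OF split_twos(2,1)]) auto
  next
    case (split i)
    \<comment> \<open>With \<open>zfib i = a + b\<close> and
      \<open>zfib (i + 1) = a + 2 * b\<close>, splitting keeps the sum and raises the sum of squares
      by exactly \<open>2 * b * b\<close>.\<close>
    define a b where "a = zfib (i - 2)" and "b = zfib (i - 1)"
    have "zfib i = b + a" "zfib (i + 1) = b + a + b"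
      using zfib_rec[of "i - 1"] zfib_rec[of i] \<open>i \<ge> 3\<close> by (auto simp: a_def b_def numeral_2_eq_2)
    moreover have "0 < b * b" by (simp add: b_def)
    moreover have "{a, zfib (i + 1)} \<subseteq> zfib ` {1..}"
      using \<open>i \<ge> 3\<close> unfolding a_def by (auto intro!: imageI simp del: add_2_eq_Suc' Suc_eq_plus1)
    ultimately show thesis
      by (intro *[OF split(3,1)]) (auto simp: power2_eq_square algebra_simps simp flip: a_def)
  qed
qed

lemma zmove_sum_mset: "zmove M N \<Longrightarrow> sum_mset N = sum_mset M"
  by (elim zmove_decompose) simp

lemma zmove_sum_squares: "zmove M N \<Longrightarrow> sum_squares M < sum_squares N"
  by (elim zmove_decompose) simp

lemma zmove_support:
  "zmove M N \<Longrightarrow> set_mset M \<subseteq> zfib ` {1..} \<Longrightarrow> set_mset N \<subseteq> zfib ` {1..}"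
  by (elim zmove_decompose) auto

lemma zmove_count:
  assumes "zmove M N"
  shows "count M x \<le> count N x + 2"
proof -
  obtain A U V where "M = A + U" "N = A + V" "size U = 2"
    using assms by (rule zmove_decompose)
  then show ?thesis using count_le_size[of U x] by simp
qed

lemma sum_squares_le: "sum_squares M \<le> (sum_mset M)\<^sup>2"
  by (induction M) (auto simp: power2_eq_square algebra_simps)

lemma diff_add_right:
  fixes U :: "'a multiset"
  assumes "U \<subseteq># M"
  shows "M - U + V + A = M + A - U + V"
  using assms by (metis add.assoc add.commute multiset_diff_union_assoc)

text \<open>Moves are local: further numbers on the board never block one. Routes computed on a
  small position thus carry over to every larger one.\<close>

lemma zmove_add: "zmove M N \<Longrightarrow> zmove (M + A) (N + A)"
proof (induction rule: zmove.induct)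
  case (combine i M)
  then have "{#zfib (i - 1), zfib i#} \<subseteq># M + A" by (simp add: subset_mset.add_increasing2)
  then show ?case
    using zmove.combine[of i "M + A"] combine by (simp only: diff_add_right)
next
  case (merge_ones M)
  then have "{#zfib 1, zfib 1#} \<subseteq># M + A" by (simp add: subset_mset.add_increasing2)
  then show ?case
    using zmove.merge_ones[of "M + A"] merge_ones by (simp only: diff_add_right)
next
  case (split_twos M)
  then have "{#zfib 2, zfib 2#} \<subseteq># M + A" by (simp add: subset_mset.add_increasing2)
  then show ?case
    using zmove.split_twos[of "M + A"] split_twos by (simp only: diff_add_right)
next
  case (split i M)
  then have "{#zfib i, zfib i#} \<subseteq># M + A" by (simp add: subset_mset.add_increasing2)
  then show ?case
    using zmove.split[of i "M + A"] split by (simp only: diff_add_right)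
qed

lemma two_subseteq_mset: "a \<in># M \<Longrightarrow> b \<in># M \<Longrightarrow> a \<noteq> b \<Longrightarrow> {#a, b#} \<subseteq># M"
  by (auto simp: subseteq_mset_def Suc_le_eq)

lemma twice_subseteq_mset: "{#a, a#} \<subseteq># M \<longleftrightarrow> 2 \<le> count M a"
  by (auto simp: subseteq_mset_def dest: spec[of _ a])

text \<open>Lets any available move serve as evidence that the game is not over, which
  \<open>zplay\<close> and \<open>legal_strategy\<close> ask for before every move.\<close>

lemma zeckendorf_no_zmove:
  assumes "zeckendorf_decomposition n M"
  shows "\<not> zmove M N"
proof
  assume "zmove M N"
  have no: "\<not> {#a, a#} \<subseteq># M" for a
  proof -
    have "count M a \<le> 1" using assms by (simp add: zeckendorf_decomposition_def)
    then show ?thesis by (simp add: twice_subseteq_mset)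
  qed
  from \<open>zmove M N\<close> show False
  proof cases
    case (combine i)
    then have "zfib (i - 1) \<in># M" "zfib (i - 1 + 1) \<in># M" "i - 1 \<ge> 1"
      by (auto dest: mset_subset_eqD)
    then show False using assms unfolding zeckendorf_decomposition_def by blast
  qed (use no in blast)+
qed

text \<open>A position without repeated and without neighbouring Fibonacci numbers is the Zeckendorf
  decomposition; a repetition allows a merge or split, and two neighbours allow a
  combination.\<close>

lemma zmove_exists:
  assumes "sum_mset M = n" "set_mset M \<subseteq> zfib ` {1..}" "\<not> zeckendorf_decomposition n M"
  obtains N where "zmove M N"
proof -
  have "(\<exists>x. 2 \<le> count M x) \<or> (\<exists>i\<ge>1. zfib i \<in># M \<and> zfib (i + 1) \<in># M)"
  proof (rule ccontr)
    assume neg: "\<not> ?thesis"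
    have "count M x \<le> 1" for x
    proof -
      have "\<not> 2 \<le> count M x" using neg by blast
      then show ?thesis by linarith
    qed
    with neg assms show False unfolding zeckendorf_decomposition_def by blast
  qed
  then consider x where "2 \<le> count M x" | i where "i \<ge> 1" "zfib i \<in># M" "zfib (i + 1) \<in># M"
    by blast
  then show thesis
  proof cases
    case 1
    then have "x \<in># M" by (cases "x \<in># M") (auto simp: not_in_iff)
    then obtain i where i: "x = zfib i" "i \<ge> 1" using assms(2) by auto
    from 1 have twice: "{#zfib i, zfib i#} \<subseteq># M" by (simp add: twice_subseteq_mset i(1))
    consider "i = 1" | "i = 2" | "i \<ge> 3" using i by linarith
    then show thesis
    proof cases
      case 1
      show thesis using twice unfolding 1 by (rule that[OF zmove.merge_ones])
    next
      case 2
      show thesis using twice unfolding 2 by (rule that[OF zmove.split_twos])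
    next
      case 3
      then show thesis using twice by (rule that[OF zmove.split])
    qed
  next
    case 2
    then have "{#zfib i, zfib (i + 1)#} \<subseteq># M"
      by (intro two_subseteq_mset) (use zfib_strict_mono[of i "i + 1"] in auto)
    then show thesis using zmove.combine[of "i + 1" M] 2 that by simp
  qed
qed

section \<open>Plays and their extension by one move\<close>

lemma zplay_invariant:
  assumes "zplay n h" "m < length h"
  shows "sum_mset (h ! m) = n \<and> set_mset (h ! m) \<subseteq> zfib ` {1..}"
  using assms(2)
proof (induction m)
  case 0
  moreover have "1 \<in> zfib ` {1..}" by (auto intro: image_eqI[of _ _ 1])
  ultimately show ?case
    using assms(1) by (auto simp: zplay_def hd_conv_nth sum_mset_replicate_mset)
next
  case (Suc m)
  then have "zmove (h ! m) (h ! Suc m)" using assms(1) by (simp add: zplay_def)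
  with Suc show ?case using zmove_sum_mset zmove_support by simp
qed

lemma zplay_snoc:
  assumes "zplay n h" "zmove (last h) N"
  shows "zplay n (h @ [N])"
proof -
  have "h \<noteq> []" using assms(1) by (simp add: zplay_def)
  have "\<not> zeckendorf_decomposition n ((h @ [N]) ! m) \<and> zmove ((h @ [N]) ! m) ((h @ [N]) ! Suc m)"
    if "Suc m < length (h @ [N])" for m
  proof (cases "Suc m < length h")
    case True
    then show ?thesis using assms(1) by (simp add: zplay_def nth_append)
  next
    case False
    with that have "m = length h - 1" "Suc m = length h" by auto
    then show ?thesis
      using assms(2) zeckendorf_no_zmove \<open>h \<noteq> []\<close> by (auto simp: nth_append last_conv_nth)
  qed
  then show ?thesis using assms(1) by (simp add: zplay_def)
qed

lemma follows_strategy_snoc: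
  assumes "follows_strategy p T \<sigma> h" "mover p (length h - 1) \<in> T \<Longrightarrow> N = \<sigma> h"
  shows "follows_strategy p T \<sigma> (h @ [N])"
  unfolding follows_strategy_def
proof (intro allI impI)
  fix m
  assume m: "Suc m < length (h @ [N]) \<and> mover p m \<in> T"
  show "(h @ [N]) ! Suc m = \<sigma> (take (Suc m) (h @ [N]))"
  proof (cases "Suc m < length h")
    case True
    then show ?thesis using assms(1) m by (simp add: follows_strategy_def nth_append)
  next
    case False
    with m have "m = length h - 1" "Suc m = length h" by auto
    then show ?thesis using assms(2) m by (simp add: nth_append)
  qed
qed

lemma relpowp_zmove_add: "(zmove ^^ m) M N \<Longrightarrow> (zmove ^^ m) (M + A) (N + A)"
proof (induction m arbitrary: N)
  case (Suc m)
  then show ?case by (auto intro: zmove_add)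
qed simp

section \<open>Explicit positions made of 1, 2, 3, 5 and 8\<close>

definition pos :: "nat \<Rightarrow> nat \<Rightarrow> nat \<Rightarrow> nat \<Rightarrow> nat \<Rightarrow> nat multiset" where
  "pos a b c d e = replicate_mset a 1 + replicate_mset b 2 + replicate_mset c 3 +
     replicate_mset d 5 + replicate_mset e 8"

lemma count_pos:
  "count (pos a b c d e) x = (if x = 1 then a else if x = 2 then b else if x = 3 then c
     else if x = 5 then d else if x = 8 then e else 0)"
  by (simp add: pos_def)

text \<open>The \<open>Suc\<close> patterns let these facts chain by plain unification when routes
  are computed.\<close>

lemma zmove_pos:
  "zmove (pos (Suc (Suc a)) b c d e) (pos a (Suc b) c d e)" (is ?m11)
  "zmove (pos (Suc a) (Suc b) c d e) (pos a b (Suc c) d e)" (is ?m12)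
  "zmove (pos a (Suc (Suc b)) c d e) (pos (Suc a) b (Suc c) d e)" (is ?m22)
  "zmove (pos a (Suc b) (Suc c) d e) (pos a b c (Suc d) e)" (is ?m23)
  "zmove (pos a b (Suc (Suc c)) d e) (pos (Suc a) b c (Suc d) e)" (is ?m33)
  "zmove (pos a b (Suc c) (Suc d) e) (pos a b c d (Suc e))" (is ?m35)
  "zmove (pos a b c (Suc (Suc d)) e) (pos a (Suc b) c d (Suc e))" (is ?m55)
proof -
  have "zmove {#1, 1#} {#2#}" using zmove.merge_ones[of "{#1, 1#}"] by simp
  from zmove_add[OF this, of "pos a b c d e"] show ?m11 by (simp add: pos_def add_mset_commute)
  have "zmove {#1, 2#} {#3#}" using zmove.combine[of 2 "{#1, 2#}"] by simp
  from zmove_add[OF this, of "pos a b c d e"] show ?m12 by (simp add: pos_def add_mset_commute)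
  have "zmove {#2, 2#} {#1, 3#}" using zmove.split_twos[of "{#2, 2#}"] by simp
  from zmove_add[OF this, of "pos a b c d e"] show ?m22 by (simp add: pos_def add_mset_commute)
  have "zmove {#2, 3#} {#5#}" using zmove.combine[of 3 "{#2, 3#}"] by simp
  from zmove_add[OF this, of "pos a b c d e"] show ?m23 by (simp add: pos_def add_mset_commute)
  have "zmove {#3, 3#} {#1, 5#}" using zmove.split[of 3 "{#3, 3#}"] by simp
  from zmove_add[OF this, of "pos a b c d e"] show ?m33 by (simp add: pos_def add_mset_commute)
  have "zmove {#3, 5#} {#8#}" using zmove.combine[of 4 "{#3, 5#}"] by simp
  from zmove_add[OF this, of "pos a b c d e"] show ?m35 by (simp add: pos_def add_mset_commute)
  have "zmove {#5, 5#} {#2, 8#}" using zmove.split[of 4 "{#5, 5#}"] by simp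
  from zmove_add[OF this, of "pos a b c d e"] show ?m55 by (simp add: pos_def add_mset_commute)
qed

text \<open>The condition on \<open>d\<close> and \<open>e\<close> rules out \<open>5+8\<close> and
  \<open>8+8\<close>, so no 13 arises and only seven kinds of move remain.\<close>

lemma zmove_pos_cases:
  assumes "zmove (pos a b c d e) N" "e = 0 \<or> e = 1 \<and> d = 0"
  obtains "2 \<le> a" "N = pos (a - 2) (b + 1) c d e"
  | "1 \<le> a" "1 \<le> b" "N = pos (a - 1) (b - 1) (c + 1) d e"
  | "2 \<le> b" "N = pos (a + 1) (b - 2) (c + 1) d e"
  | "1 \<le> b" "1 \<le> c" "N = pos a (b - 1) (c - 1) (d + 1) e"
  | "2 \<le> c" "N = pos (a + 1) b (c - 2) (d + 1) e"
  | "1 \<le> c" "1 \<le> d" "N = pos a b (c - 1) (d - 1) (e + 1)"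
  | "2 \<le> d" "N = pos a (b + 1) c (d - 2) (e + 1)"
proof -
  note defs = multiset_eq_iff count_pos
  have small: "i \<le> 5" if "zfib i \<in># pos a b c d e" "1 \<le> i" for i
  proof (rule ccontr)
    assume "\<not> i \<le> 5"
    then have "8 < zfib i" using zfib_strict_mono[of 5 i] by simp
    with that(1) show False by (simp add: count_pos flip: count_greater_zero_iff split: if_splits)
  qed
  from assms(1) show thesis
  proof cases
    case (combine i)
    then have mem: "1 \<le> count (pos a b c d e) (zfib (i - 1))" "1 \<le> count (pos a b c d e) (zfib i)"
      using mset_subset_eqD[OF combine(3)] by (simp_all add: Suc_le_eq)
    then have "i \<le> 5" using small combine(2) by (simp add: Suc_le_eq)
    with combine(2) consider "i = 2" | "i = 3" | "i = 4" | "i = 5" by linarith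
    then show thesis
    proof cases
      case 1
      with mem combine(1) show thesis by (intro that(2)) (auto simp: defs)
    next
      case 2
      with mem combine(1) show thesis by (intro that(4)) (auto simp: defs)
    next
      case 3
      with mem combine(1) show thesis by (intro that(6)) (auto simp: defs)
    next
      case 4
      with mem assms(2) show thesis by (simp add: count_pos)
    qed
  next
    case merge_ones
    then show thesis by (intro that(1)) (auto simp: defs twice_subseteq_mset)
  next
    case split_twos
    then show thesis by (intro that(3)) (auto simp: defs twice_subseteq_mset)
  next
    case (split i)
    then have mem: "2 \<le> count (pos a b c d e) (zfib i)" by (simp add: twice_subseteq_mset)
    then have "zfib i \<in># pos a b c d e" by (cases "zfib i \<in># pos a b c d e") (auto simp: not_in_iff)
    with small split(2) have "i \<le> 5" by simp
    with split(2) consider "i = 3" | "i = 4" | "i = 5" by linarith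
    then show thesis
    proof cases
      case 1
      with mem split(1) show thesis by (intro that(5)) (auto simp: defs)
    next
      case 2
      with mem split(1) show thesis by (intro that(7)) (auto simp: defs)
    next
      case 3
      with mem assms(2) show thesis by (simp add: count_pos)
    qed
  qed
qed

section \<open>Two routes of different length to one position\<close>

text \<open>Here \<open>l\<close> is the number of successive opponent turns at hand and
  \<open>k\<close> the least delay that moves the team's turns off themselves. Bounding the longer
  route bounds both.\<close>

definition shiftable :: "nat \<Rightarrow> nat \<Rightarrow> nat multiset \<Rightarrow> bool" where
  "shiftable k l M \<longleftrightarrow>
    (\<exists>m d N. (zmove ^^ m) M N \<and> (zmove ^^ (m + d)) M N \<and> k \<le> d \<and> m + d \<le> l)"

lemma shiftableI:
  "(zmove ^^ m) M N \<Longrightarrow> (zmove ^^ m') M N \<Longrightarrow> m + k \<le> m' \<Longrightarrow> m' \<le> l \<Longrightarrow> shiftable k l M"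
  unfolding shiftable_def by (rule exI[of _ m], rule exI[of _ "m' - m"]) auto

lemma zmove_path_Cons: "zmove M N \<Longrightarrow> (zmove ^^ m) N A \<Longrightarrow> (zmove ^^ Suc m) M A"
  by (rule relpowp_Suc_I2)

text \<open>Item 1 ends a route; items 2 to 8 prepend \<open>1+1\<close>, \<open>1+2\<close>,
  \<open>2+2\<close>, \<open>2+3\<close>, \<open>3+3\<close>, \<open>3+5\<close>, \<open>5+5\<close>
  in this order.\<close>

lemmas zmove_path_pos = relpowp_0_I zmove_pos[THEN zmove_path_Cons]

text \<open>The detour through \<open>2+2\<close> borrows a fourth one and gives it back, so both
  routes need four ones and spend three.\<close>

lemma three_from_ones:
  "(zmove ^^ Suc (Suc 0)) (pos (Suc (Suc (Suc (Suc a)))) 0 c 0 0) (pos (Suc a) 0 (Suc c) 0 0)"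
  "(zmove ^^ Suc (Suc (Suc 0))) (pos (Suc (Suc (Suc (Suc a)))) 0 c 0 0) (pos (Suc a) 0 (Suc c) 0 0)"
proof -
  note path = zmove_path_pos
  show "(zmove ^^ Suc (Suc 0)) (pos (Suc (Suc (Suc (Suc a)))) 0 c 0 0) (pos (Suc a) 0 (Suc c) 0 0)"
    by (rule path(2), rule path(3), rule path(1))
  show "(zmove ^^ Suc (Suc (Suc 0))) (pos (Suc (Suc (Suc (Suc a)))) 0 c 0 0) (pos (Suc a) 0 (Suc c) 0 0)"
    by (rule path(2), rule path(2), rule path(4), rule path(1))
qed

lemma threes_from_ones:
  "(zmove ^^ (2 * j)) (pos (3 * j + Suc a) 0 c 0 0) (pos (Suc a) 0 (c + j) 0 0)"
  "(zmove ^^ (3 * j)) (pos (3 * j + Suc a) 0 c 0 0) (pos (Suc a) 0 (c + j) 0 0)"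
proof (induction j arbitrary: c)
  case (Suc j)
  have start: "3 * Suc j + Suc a = Suc (Suc (Suc (Suc (3 * j + a))))" by simp
  have length: "2 * Suc j = Suc (Suc 0) + 2 * j" "3 * Suc j = Suc (Suc (Suc 0)) + 3 * j" by simp_all
  case 1
  show ?case
    unfolding start length
    using relpowp_trans[OF three_from_ones(1)[of "3 * j + a" c] Suc(1)[of "Suc c", simplified]]
    by (simp only: add_Suc_right add_Suc add_0_left)
  case 2
  show ?case
    unfolding start length
    using relpowp_trans[OF three_from_ones(2)[of "3 * j + a" c] Suc(2)[of "Suc c", simplified]]
    by (simp only: add_Suc_right add_Suc add_0_left)
qed simp_all

text \<open>The detour makes a second 3 and splits \<open>3+3\<close>. It borrows two ones, returned
  by \<open>2+2\<close> and \<open>3+3\<close>, and takes two moves more.\<close>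

lemma five_from_three:
  "(zmove ^^ Suc (Suc 0)) (pos (Suc (Suc (Suc (Suc a)))) b (Suc c) d e) (pos (Suc (Suc a)) b c (Suc d) e)"
  "(zmove ^^ Suc (Suc (Suc (Suc 0)))) (pos (Suc (Suc (Suc (Suc a)))) b (Suc c) d e) (pos (Suc (Suc a)) b c (Suc d) e)"
proof -
  note path = zmove_path_pos
  show "(zmove ^^ Suc (Suc 0)) (pos (Suc (Suc (Suc (Suc a)))) b (Suc c) d e) (pos (Suc (Suc a)) b c (Suc d) e)"
    by (rule path(2), rule path(5), rule path(1))
  show "(zmove ^^ Suc (Suc (Suc (Suc 0)))) (pos (Suc (Suc (Suc (Suc a)))) b (Suc c) d e) (pos (Suc (Suc a)) b c (Suc d) e)"
    by (rule path(2), rule path(2), rule path(4), rule path(6), rule path(1))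
qed

text \<open>Making \<open>k - 2\<close> threes gains \<open>k - 2\<close> moves and one 5 gains two
  more, a total delay of \<open>k\<close>. The longer route has \<open>3 * (k - 2) + 4\<close>
  moves, and the same number of ones is needed. At least one 3 must be made first, hence
  \<open>k\<close> is at least 3.\<close>

lemma shiftable_from_ones:
  assumes "3 \<le> k" "3 * k - 2 \<le> count M 1"
  shows "shiftable k (3 * k - 2) M"
proof -
  obtain j where k: "k = j + 3" using assms(1) by (metis add.commute le_Suc_ex)
  define A where "A = M - pos (3 * (j + 1) + Suc 3) 0 0 0 0"
  have "pos (3 * (j + 1) + Suc 3) 0 0 0 0 \<subseteq># M"
    using assms(2) by (auto simp: subseteq_mset_def count_pos k)
  then have M: "M = pos (3 * (j + 1) + Suc 3) 0 0 0 0 + A" by (simp add: A_def)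
  have "pos (Suc 3) 0 (0 + (j + 1)) 0 0 = pos (Suc (Suc (Suc (Suc 0)))) 0 (Suc j) 0 0"
    by (simp add: eval_nat_numeral)
  note five = five_from_three[of 0 0 j 0 0, folded this]
  show ?thesis
    unfolding M
    by (rule shiftableI[OF relpowp_trans[OF threes_from_ones(1) five(1), THEN relpowp_zmove_add]
          relpowp_trans[OF threes_from_ones(2) five(2), THEN relpowp_zmove_add]]) (simp_all add: k)
qed

text \<open>These are the targets for \<open>k = 2\<close>, where a block has four turns. The first
  three give routes of 2 and 4 moves, the last one of 1 and 4 moves.\<close>

lemma shiftable_pos:
  shows "4 \<le> a \<Longrightarrow> 1 \<le> c \<Longrightarrow> shiftable 2 4 (pos a b c d e)"
    and "3 \<le> a \<Longrightarrow> 2 \<le> b \<Longrightarrow> shiftable 2 4 (pos a b c d e)"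
    and "1 \<le> a \<Longrightarrow> 2 \<le> b \<Longrightarrow> 2 \<le> d \<Longrightarrow> shiftable 2 4 (pos a b c d e)"
    and "2 \<le> a \<Longrightarrow> 1 \<le> c \<Longrightarrow> 2 \<le> d \<Longrightarrow> shiftable 2 4 (pos a b c d e)"
proof -
  note path = zmove_path_pos
  show "shiftable 2 4 (pos a b c d e)" if le: "4 \<le> a" "1 \<le> c"
  proof -
    obtain a' c' where "a = 4 + a'" "c = 1 + c'"
      using le(1)[THEN le_Suc_ex] le(2)[THEN le_Suc_ex] by blast
    then have eqs: "a = Suc (Suc (Suc (Suc a')))" "c = Suc c'"
      by simp_all
    then show ?thesis by (simp add: shiftableI[OF five_from_three])
  qed
  show "shiftable 2 4 (pos a b c d e)" if le: "3 \<le> a" "2 \<le> b"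
  proof -
    obtain a' b' where "a = 3 + a'" "b = 2 + b'"
      using le(1)[THEN le_Suc_ex] le(2)[THEN le_Suc_ex] by blast
    then have eqs: "a = Suc (Suc (Suc a'))" "b = Suc (Suc b')"
      by simp_all
    have "(zmove ^^ Suc (Suc 0)) (pos a b c d e) (pos (Suc a') b' (Suc (Suc c)) d e)"
      unfolding eqs
      by (rule path(3), rule path(3), rule path(1))
    moreover have "(zmove ^^ Suc (Suc (Suc (Suc 0)))) (pos a b c d e) (pos (Suc a') b' (Suc (Suc c)) d e)"
      unfolding eqs
      by (rule path(4), rule path(2), rule path(2), rule path(4), rule path(1))
    ultimately show ?thesis by (rule shiftableI) simp_all
  qed
  show "shiftable 2 4 (pos a b c d e)" if le: "1 \<le> a" "2 \<le> b" "2 \<le> d"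
  proof -
    obtain a' b' d' where "a = 1 + a'" "b = 2 + b'" "d = 2 + d'"
      using le(1)[THEN le_Suc_ex] le(2)[THEN le_Suc_ex] le(3)[THEN le_Suc_ex] by blast
    then have eqs: "a = Suc a'" "b = Suc (Suc b')" "d = Suc (Suc d')"
      by simp_all
    have "(zmove ^^ Suc (Suc 0)) (pos a b c d e) (pos a' (Suc b') c (Suc d') (Suc e))"
      unfolding eqs
      by (rule path(3), rule path(7), rule path(1))
    moreover have "(zmove ^^ Suc (Suc (Suc (Suc 0)))) (pos a b c d e) (pos a' (Suc b') c (Suc d') (Suc e))"
      unfolding eqs
      by (rule path(8), rule path(4), rule path(2), rule path(5), rule path(1))
    ultimately show ?thesis by (rule shiftableI) simp_all
  qed
  show "shiftable 2 4 (pos a b c d e)" if le: "2 \<le> a" "1 \<le> c" "2 \<le> d"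
  proof -
    obtain a' c' d' where "a = 2 + a'" "c = 1 + c'" "d = 2 + d'"
      using le(1)[THEN le_Suc_ex] le(2)[THEN le_Suc_ex] le(3)[THEN le_Suc_ex] by blast
    then have eqs: "a = Suc (Suc a')" "c = Suc c'" "d = Suc (Suc d')"
      by simp_all
    have "(zmove ^^ Suc 0) (pos a b c d e) (pos a b c' (Suc d') (Suc e))"
      unfolding eqs
      by (rule path(7), rule path(1))
    moreover have "(zmove ^^ Suc (Suc (Suc (Suc 0)))) (pos a b c d e) (pos a b c' (Suc d') (Suc e))"
      unfolding eqs
      by (rule path(8), rule path(2), rule path(4), rule path(6), rule path(1))
    ultimately show ?thesis by (rule shiftableI) simp_all
  qed
qed

text \<open>Together with the next lemma, this fills a whole block of four opponent turns and leaves
  a new 5 as its only trace besides the numbers consumed.\<close>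

lemma five_from_ones:
  assumes "5 \<le> a"
  shows "(zmove ^^ 4) (pos a b c d e) (pos (a - 5) b c (d + 1) e)"
proof -
  note path = zmove_path_pos
  obtain a' where "a = 5 + a'" using assms[THEN le_Suc_ex] by blast
  then have eqs: "a = Suc (Suc (Suc (Suc (Suc a'))))" by simp
  have "(zmove ^^ Suc (Suc (Suc (Suc 0)))) (pos a b c d e) (pos a' b c (Suc d) e)"
    unfolding eqs
    by (rule path(2), rule path(3), rule path(2), rule path(5), rule path(1))
  then show ?thesis by (simp add: eqs numeral_eq_Suc)
qed

lemma five_from_ones_two:
  assumes "4 \<le> a" "1 \<le> b"
  shows "(zmove ^^ 4) (pos a b c d e) (pos (a - 3) (b - 1) c (d + 1) e)"
proof -
  note path = zmove_path_pos
  obtain a' b' where "a = 4 + a'" "b = 1 + b'" using assms[THEN le_Suc_ex] by blast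
  then have eqs: "a = Suc (Suc (Suc (Suc a')))" "b = Suc b'" by simp_all
  have "(zmove ^^ Suc (Suc (Suc (Suc 0)))) (pos a b c d e) (pos (Suc a') b' c (Suc d) e)"
    unfolding eqs
    by (rule path(2), rule path(4), rule path(2), rule path(5), rule path(1))
  then show ?thesis by (simp add: eqs numeral_eq_Suc)
qed

section \<open>Consequences of a winning strategy\<close>

locale winning_team =
  fixes n p :: nat and T :: "nat set" and \<sigma> :: "nat multiset list \<Rightarrow> nat multiset"
  assumes legal: "legal_strategy n p T \<sigma>"
    and wins: "\<And>h. complete_zplay n h \<Longrightarrow> follows_strategy p T \<sigma> h \<Longrightarrow> won_by p T h"
begin

text \<open>Keeps only position and time. The history, on which the strategy may depend, is hidden
  in the existential: at opponent turns every move can be followed, at team turns only the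
  prescribed one.\<close>

definition occurs :: "nat \<Rightarrow> nat multiset \<Rightarrow> bool" where
  "occurs a M \<longleftrightarrow>
    (\<exists>h. zplay n h \<and> follows_strategy p T \<sigma> h \<and> length h = Suc a \<and> last h = M)"

lemma occurs_start: "occurs 0 (replicate_mset n 1)"
  unfolding occurs_def
  by (rule exI[of _ "[replicate_mset n 1]"]) (simp add: zplay_def follows_strategy_def)

lemma occurs_Suc:
  assumes "zplay n h" "follows_strategy p T \<sigma> h" "length h = Suc a" "zmove (last h) N"
    "mover p a \<in> T \<Longrightarrow> N = \<sigma> h"
  shows "occurs (Suc a) N"
  unfolding occurs_def
  using assms by (intro exI[of _ "h @ [N]"]) (auto intro: zplay_snoc follows_strategy_snoc)

lemma occurs_opponent_move:
  "occurs a M \<Longrightarrow> mover p a \<notin> T \<Longrightarrow> zmove M N \<Longrightarrow> occurs (Suc a) N"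
  by (subst (asm) occurs_def) (auto intro: occurs_Suc)

text \<open>The move to \<open>N\<close> merely certifies that the game is not over; on the team's
  turn the strategy may answer differently.\<close>

lemma occurs_some_move:
  assumes "occurs a M" "zmove M N"
  obtains N' where "zmove M N'" "occurs (Suc a) N'"
proof (cases "mover p a \<in> T")
  case True
  obtain h where h: "zplay n h" "follows_strategy p T \<sigma> h" "length h = Suc a" "last h = M"
    using assms(1) unfolding occurs_def by blast
  then have "zmove M (\<sigma> h)"
    using True assms(2) legal zeckendorf_no_zmove unfolding legal_strategy_def by auto
  moreover have "occurs (Suc a) (\<sigma> h)"
    using h \<open>zmove M (\<sigma> h)\<close> by (intro occurs_Suc) auto
  ultimately show thesis using that by blast
next
  case False
  then show thesis using that assms occurs_opponent_move by blast
qed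

text \<open>The two histories are extended by the same moves; the strategy is consulted in whichever of them
  it is the team's turn, which by disjointness never happens in both at once.\<close>

lemma occurs_shifted_False:
  assumes "occurs a M" "occurs (a + d) M"
    and disjoint: "\<And>m. mover p m \<in> T \<Longrightarrow> mover p (m + d) \<notin> T"
  shows False
proof -
  have False if "zplay n g" "follows_strategy p T \<sigma> g" "length g = Suc a"
    "zplay n h" "follows_strategy p T \<sigma> h" "length h = Suc (a + d)" "last h = last g" for g h a
    using that
  proof (induction "n\<^sup>2 - sum_squares (last g)" arbitrary: g h a rule: less_induct)
    case less
    have [simp]: "g \<noteq> []" "h \<noteq> []" using less.prems(3,6) by auto
    have inv: "sum_mset (last g) = n" "set_mset (last g) \<subseteq> zfib ` {1..}"
      using zplay_invariant[OF less.prems(1), of a] less.prems(3) by (simp_all add: last_conv_nth)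
    show False
    proof (cases "zeckendorf_decomposition n (last g)")
      case True
      then have "won_by p T g" "won_by p T h"
        using wins less.prems unfolding complete_zplay_def by auto
      then show False
        \<comment> \<open>The final moves have numbers \<open>a - 1\<close> and
          \<open>a + d - 1\<close>. A win requires at least one move, so \<open>a\<close> is
          positive and they differ by exactly \<open>d\<close>.\<close>
        using disjoint[of "a - 1"] less.prems(3,6) by (auto simp: won_by_def)
    next
      case False
      have "\<exists>N. zmove (last g) N \<and> (mover p a \<in> T \<longrightarrow> N = \<sigma> g) \<and> (mover p (a + d) \<in> T \<longrightarrow> N = \<sigma> h)"
      proof -
        have "zmove (last g) (\<sigma> g)" if "mover p a \<in> T"
          using that legal less.prems(1,3) False unfolding legal_strategy_def by auto
        moreover have "zmove (last g) (\<sigma> h)" if "mover p (a + d) \<in> T"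
          using that legal less.prems(4,6,7) False unfolding legal_strategy_def by fastforce
        moreover obtain N where "zmove (last g) N" using zmove_exists[OF inv False] .
        ultimately show ?thesis using disjoint[of a] by blast
      qed
      then obtain N where N: "zmove (last g) N" "mover p a \<in> T \<Longrightarrow> N = \<sigma> g"
        "mover p (a + d) \<in> T \<Longrightarrow> N = \<sigma> h" by blast
      have "sum_squares N \<le> n\<^sup>2"
        using sum_squares_le[of N] zmove_sum_mset[OF N(1)] inv by simp
      with zmove_sum_squares[OF N(1)] have "n\<^sup>2 - sum_squares N < n\<^sup>2 - sum_squares (last g)"
        by linarith
      then show False
        using less.prems N
        by (intro less.hyps[where g = "g @ [N]" and h = "h @ [N]" and a = "Suc a"])
          (auto intro: zplay_snoc follows_strategy_snoc)
    qed
  qed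
  then show False using assms(1,2) unfolding occurs_def by metis
qed

lemma occurs_opponent_moves:
  assumes "occurs a M" "(zmove ^^ m) M N" "\<And>j. j < m \<Longrightarrow> mover p (a + j) \<notin> T"
  shows "occurs (a + m) N"
  using assms(2,3)
proof (induction m arbitrary: N)
  case 0
  then show ?case using assms(1) by simp
next
  case (Suc m)
  then show ?case by (auto intro!: occurs_opponent_move)
qed

lemma occurs_shiftable_False:
  assumes "occurs a M" "shiftable k l M" "\<And>j. j < l \<Longrightarrow> mover p (a + j) \<notin> T"
    and "\<And>d m. k \<le> d \<Longrightarrow> d \<le> l \<Longrightarrow> mover p m \<in> T \<Longrightarrow> mover p (m + d) \<notin> T"
  shows False
proof -
  obtain m d N where N: "(zmove ^^ m) M N" "(zmove ^^ (m + d)) M N" "k \<le> d" "m + d \<le> l"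
    using assms(2) unfolding shiftable_def by blast
  have "occurs (a + m) N"
    by (rule occurs_opponent_moves[OF assms(1) N(1)]) (use assms(3) N(4) in auto)
  moreover have "occurs (a + m + d) N"
    unfolding add.assoc
    by (rule occurs_opponent_moves[OF assms(1) N(2)]) (use assms(3) N(4) in auto)
  ultimately show False
    by (rule occurs_shifted_False) (use assms(4) N(3,4) in auto)
qed

text \<open>Whoever moves, at most two ones disappear per move, and while two ones remain the game
  goes on.\<close>

lemma occurs_many_ones:
  "2 * j \<le> n \<Longrightarrow> \<exists>M. occurs j M \<and> n \<le> count M 1 + 2 * j"
proof (induction j)
  case 0
  show ?case using occurs_start by (intro exI[of _ "replicate_mset n 1"]) simp
next
  case (Suc j)
  then obtain M where M: "occurs j M" "n \<le> count M 1 + 2 * j" by auto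
  then have "{#zfib 1, zfib 1#} \<subseteq># M" using Suc.prems by (simp add: twice_subseteq_mset)
  then obtain N where "zmove M N" "occurs (Suc j) N"
    using occurs_some_move[OF M(1)] zmove.merge_ones by blast
  then show ?case using M(2) zmove_count[of M N 1] by (intro exI[of _ N]) simp
qed

lemma occurs_pos_some_move:
  assumes "occurs m (pos a b c d e)" "2 \<le> a"
  shows "\<exists>N. zmove (pos a b c d e) N \<and> occurs (Suc m) N"
proof -
  obtain a' where "a = 2 + a'" using assms(2)[THEN le_Suc_ex] by blast
  then have "zmove (pos a b c d e) (pos a' (Suc b) c d e)" using zmove_pos(1) by simp
  then show ?thesis using occurs_some_move[OF assms(1)] by blast
qed

end

section \<open>Timing of a team with consecutive turns\<close>

text \<open>The offset \<open>r\<close> rotates the clock: residues \<open>0..k-1\<close> of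
  \<open>m + r\<close> belong to the team, the other \<open>k * k\<close> to its opponents. Move 0
  has residue \<open>r\<close>, so a team wrapping around from \<open>p\<close> to 1 needs no
  special treatment.\<close>

locale team_block = winning_team +
  fixes k r :: nat
  assumes p_eq: "p = (k + 1) * k" and r_less: "r < p"
    and turn: "mover p m \<in> T \<longleftrightarrow> (m + r) mod p < k"
begin

text \<open>A residue below \<open>k\<close> plus \<open>d\<close> lies between \<open>k\<close> and
  \<open>k * k + k - 1\<close>, so it leaves the team's range without wrapping around modulo
  \<open>p\<close>.\<close>

lemma turn_shifted:
  assumes "k \<le> d" "d \<le> k\<^sup>2" "mover p m \<in> T"
  shows "mover p (m + d) \<notin> T"
proof -
  have less: "(m + r) mod p < k" using assms(3) turn by simp
  have "(m + d + r) mod p = ((m + r) mod p + d) mod p"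
    by (simp add: mod_simps algebra_simps)
  also have "\<dots> = (m + r) mod p + d"
    using less assms(2) by (intro mod_less) (simp add: p_eq power2_eq_square algebra_simps)
  finally show ?thesis using assms(1) turn by simp
qed

lemma opponent_block_False:
  assumes "occurs a M" "shiftable k l M" "l \<le> k\<^sup>2" "k \<le> (a + r) mod p" "(a + r) mod p + l \<le> p"
  shows False
proof (rule occurs_shiftable_False[OF assms(1,2)])
  fix j assume "j < l"
  have "(a + j + r) mod p = ((a + r) mod p + j) mod p"
    by (simp add: mod_simps algebra_simps)
  also have "\<dots> = (a + r) mod p + j" using \<open>j < l\<close> assms(5) by (intro mod_less) simp
  finally show "mover p (a + j) \<notin> T" using assms(4) turn by simp
next
  fix d m assume "k \<le> d" "d \<le> l" "mover p m \<in> T"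
  then show "mover p (m + d) \<notin> T" using turn_shifted assms(3) by simp
qed

lemma large_block_False:
  assumes "3 \<le> k" "2 * k\<^sup>2 + 4 * k \<le> n"
  shows False
proof -
  have k2: "3 * k \<le> k\<^sup>2" "k\<^sup>2 + k = p" using assms(1) by (simp_all add: p_eq power2_eq_square)
  \<comment> \<open>Serves the latest start considered below, at move \<open>p - r + k\<close> with
    \<open>p - r\<close> at most \<open>3 * k - 3\<close>.\<close>
  have quadratic: "11 * k \<le> 2 * k\<^sup>2 + 4 * k + 8"
  proof -
    obtain j where "k = 3 + j" using assms(1) le_Suc_ex by blast
    then show ?thesis by (simp add: power2_eq_square algebra_simps)
  qed
  have False if a: "2 * a + 3 * k \<le> n + 2" "(a + r) mod p = k" for a
  proof -
    obtain M where "occurs a M" "n \<le> count M 1 + 2 * a"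
      using occurs_many_ones[of a] a(1) assms(1) by auto
    moreover from this have "shiftable k (3 * k - 2) M"
      using a(1) assms(1) by (intro shiftable_from_ones) auto
    moreover have "3 * k - 2 \<le> k\<^sup>2" "k + (3 * k - 2) \<le> p" using k2 by linarith+
    ultimately show False using opponent_block_False[of a M "3 * k - 2"] a(2) by simp
  qed
  note block = this
  \<comment> \<open>The game opens in the team's turns, in an opponents' block with enough turns
    left, or too late in such a block. The routes start at the next full block, at once, or after
    the team's next \<open>k\<close> turns, respectively.\<close>
  consider "r < k" | "k \<le> r" "3 * k - 2 \<le> p - r" | "k \<le> r" "p - r < 3 * k - 2" by linarith
  then show False
  proof cases
    case 1
    have "2 * (k - r) + 3 * k \<le> n + 2" using k2(1) assms(2) by linarith
    moreover have "(k - r + r) mod p = k" using 1 k2 assms(1) by simp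
    ultimately show False by (rule block)
  next
    case 2
    have "shiftable k (3 * k - 2) (replicate_mset n 1)"
      using k2 assms by (intro shiftable_from_ones) auto
    moreover have "r + (3 * k - 2) \<le> p" "3 * k - 2 \<le> k\<^sup>2" using 2 k2 r_less by linarith+
    ultimately show False
      using opponent_block_False[OF occurs_start, of "3 * k - 2"] 2 r_less by simp
  next
    case 3
    have "(p - r + k + r) mod p = (p + k) mod p" using r_less by simp
    also have "\<dots> = k" using k2 assms(1) by simp
    finally have "(p - r + k + r) mod p = k" .
    moreover have "p - r + 3 \<le> 3 * k" using 3(2) by simp
    then have "2 * (p - r + k) + 3 * k + 6 \<le> 11 * k" by simp
    then have "2 * (p - r + k) + 3 * k \<le> n + 2" using quadratic assms(2) by linarith
    ultimately show False using block by blast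
  qed
qed

text \<open>If the team is to move with \<open>5\<close> next to ones, it must leave \<open>2, 2\<close> or \<open>3\<close> to a full block of
  opponents. With \<open>3\<close> next to ones, it can only avoid such a position by producing \<open>5\<close>, which the
  opponents extend to \<open>5, 5\<close> so that the next block is winning for them in any case. One of these two
  situations can be forced unless the first full block of opponents is good enough already.\<close>

lemma small_block_False:
  assumes "k = 2" "16 \<le> n"
  shows False
proof -
  have p: "p = 6" using assms(1) by (simp add: p_eq)
  \<comment> \<open>Whenever a move is requested below, at most twelve ones are gone, so
    \<open>1+1\<close> is available.\<close>
  have ge: "2 \<le> n" and le: "\<And>j. j \<le> 12 \<Longrightarrow> 2 \<le> n - j" using assms(2) by linarith+
  have block: False if "occurs m M" "shiftable 2 4 M" "(m + r) mod 6 = 2" for m M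
    using opponent_block_False[OF that(1), of 4] that p assms(1) by simp
  have opponents: "occurs (m + j) N"
    if "occurs m M" "(zmove ^^ j) M N" "\<And>i. i < j \<Longrightarrow> 2 \<le> (m + i + r) mod 6" for m j M N
    by (rule occurs_opponent_moves[OF that(1,2)]) (use that(3) turn p assms(1) in fastforce)
  have five: False if occ: "occurs m (pos (n - 5) 0 0 1 0)" and m: "(m + r) mod 6 = 0" for m
  proof -
    have time: "(Suc (Suc m) + r) mod 6 = 2" using m by presburger
    obtain N where "zmove (pos (n - 5) 0 0 1 0) N" and N: "occurs (Suc m) N"
      using occurs_pos_some_move[OF occ le] by auto
    then have occ: "occurs (Suc m) (pos (n - 7) 1 0 1 0)"
      by (auto elim!: zmove_pos_cases)
    then obtain N where "zmove (pos (n - 7) 1 0 1 0) N" and N: "occurs (Suc (Suc m)) N"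
      using occurs_pos_some_move[OF occ le] by auto
    then show False
      using block[OF N _ time] shiftable_pos assms(2) by (auto elim!: zmove_pos_cases)
  qed
  have three: False if occ: "occurs m (pos (n - 3) 0 1 0 0)" and m: "(m + r) mod 6 = 0" for m
  proof -
    have time: "(Suc (Suc m) + r) mod 6 = 2" using m by presburger
    obtain N where "zmove (pos (n - 3) 0 1 0 0) N" and N: "occurs (Suc m) N"
      using occurs_pos_some_move[OF occ le] by auto
    then have occ: "occurs (Suc m) (pos (n - 5) 1 1 0 0)"
      by (auto elim!: zmove_pos_cases)
    then obtain N where "zmove (pos (n - 5) 1 1 0 0) N" and N: "occurs (Suc (Suc m)) N"
      using occurs_pos_some_move[OF occ le] by auto
    \<comment> \<open>The replies \<open>1+1\<close> and \<open>1+2\<close> are refuted by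
      \<open>block\<close>; only \<open>2+3\<close> survives.\<close>
    then have occ: "occurs (Suc (Suc m)) (pos (n - 5) 0 0 1 0)"
      using block[OF N _ time] shiftable_pos assms(2) by (auto elim!: zmove_pos_cases)
    let ?m = "m + 6"
    have "occurs (Suc (Suc m) + 4) (pos (n - 5 - 5) 0 0 (1 + 1) 0)"
      by (rule opponents[OF occ five_from_ones]) (use assms(2) m in \<open>simp, presburger\<close>)
    then have occ: "occurs ?m (pos (n - 10) 0 0 2 0)" by (simp add: numeral_2_eq_2 add.commute)
    have time: "(Suc (Suc ?m) + r) mod 6 = 2" using m by presburger
    obtain N where "zmove (pos (n - 10) 0 0 2 0) N" and N: "occurs (Suc ?m) N"
      using occurs_pos_some_move[OF occ le] by auto
    then have "occurs (Suc ?m) (pos (n - 12) 1 0 2 0) \<or> occurs (Suc ?m) (pos (n - 10) 1 0 0 1)"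
      using assms(2) by (auto elim!: zmove_pos_cases)
    then show False
    proof
      \<comment> \<open>Ones are scarcest here: for \<open>n = 16\<close>, \<open>1+1\<close> leaves
        two of them and \<open>1+2\<close> three. The last two cases of \<open>shiftable_pos\<close>
        cover these positions, using the two fives.\<close>
      assume occ: "occurs (Suc ?m) (pos (n - 12) 1 0 2 0)"
      then obtain N where "zmove (pos (n - 12) 1 0 2 0) N" and N: "occurs (Suc (Suc ?m)) N"
        using occurs_pos_some_move[OF occ le] by auto
      then show False
        using block[OF N _ time] shiftable_pos assms(2) by (auto elim!: zmove_pos_cases)
    next
      assume occ: "occurs (Suc ?m) (pos (n - 10) 1 0 0 1)"
      then obtain N where "zmove (pos (n - 10) 1 0 0 1) N" and N: "occurs (Suc (Suc ?m)) N"
        using occurs_pos_some_move[OF occ le] by auto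
      then show False
        using block[OF N _ time] shiftable_pos assms(2) by (auto elim!: zmove_pos_cases)
    qed
  qed
  have start: "occurs 0 (pos n 0 0 0 0)" using occurs_start by (simp add: pos_def)
  have two: "zmove (pos n 0 0 0 0) (pos (n - 2) 1 0 0 0)"
    using zmove_pos(1)[of "n - 2" 0 0 0 0] assms(2) by (simp add: numeral_2_eq_2 Suc_diff_Suc)
  have ones: "Suc (n - 4) = n - 3" "3 * 1 + (n - 3) = n" using assms(2) by simp_all
  have three_paths: "(zmove ^^ 2) (pos n 0 0 0 0) (pos (n - 3) 0 1 0 0)"
    "(zmove ^^ 3) (pos n 0 0 0 0) (pos (n - 3) 0 1 0 0)"
    using threes_from_ones[of 1 "n - 4" 0, unfolded ones] by simp_all
  \<comment> \<open>For \<open>r = 0\<close> and \<open>r = 5\<close>, every position left to the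
    first full block is good. For \<open>r = 1\<close> and \<open>r = 2\<close> a full block
    prepares \<open>five\<close>; for \<open>r = 3\<close> and \<open>r = 4\<close> the initial
    three or two opponent turns prepare \<open>three\<close>.\<close>
  consider "r = 0" | "r = 1" | "r = 2" | "r = 3" | "r = 4" | "r = 5"
    using r_less p by linarith
  then show False
  proof cases
    case 1
    obtain N where "zmove (pos n 0 0 0 0) N" and N: "occurs (Suc 0) N"
      using occurs_pos_some_move[OF start ge] by blast
    then have occ: "occurs (Suc 0) (pos (n - 2) 1 0 0 0)"
      by (auto elim!: zmove_pos_cases)
    then obtain N where "zmove (pos (n - 2) 1 0 0 0) N" and N: "occurs (Suc (Suc 0)) N"
      using occurs_pos_some_move[OF occ le] by auto
    then show False
      using block[OF N] 1 shiftable_pos assms(2) by (auto elim!: zmove_pos_cases)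
  next
    case 2
    have turns: "2 \<le> (Suc 0 + i + r) mod 6" if "i < 4" for i
      using that 2 by presburger
    obtain N where "zmove (pos n 0 0 0 0) N" and N: "occurs (Suc 0) N"
      using occurs_pos_some_move[OF start ge] by blast
    then have "occurs (Suc 0) (pos (n - 2) 1 0 0 0)"
      by (auto elim!: zmove_pos_cases)
    then have "occurs (Suc 0 + 4) (pos (n - 2 - 3) (1 - 1) 0 (0 + 1) 0)"
      by (rule opponents[OF _ five_from_ones_two]) (use assms(2) turns in simp_all)
    then show False using five[of 5] 2 by simp
  next
    case 3
    have turns: "2 \<le> (0 + i + r) mod 6" if "i < 4" for i
      using that 3 by presburger
    have "occurs (0 + 4) (pos (n - 5) 0 0 (0 + 1) 0)"
      by (rule opponents[OF start five_from_ones]) (use assms(2) turns in simp_all)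
    then show False using five[of 4] 3 by simp
  next
    case 4
    have turns: "2 \<le> (0 + i + r) mod 6" if "i < 3" for i
      using that 4 by presburger
    have "occurs (0 + 3) (pos (n - 3) 0 1 0 0)"
      by (rule opponents[OF start three_paths(2)]) (rule turns)
    then show False using three[of 3] 4 by simp
  next
    case 5
    have turns: "2 \<le> (0 + i + r) mod 6" if "i < 2" for i
      using that 5 by presburger
    have "occurs (0 + 2) (pos (n - 3) 0 1 0 0)"
      by (rule opponents[OF start three_paths(1)]) (rule turns)
    then show False using three[of 2] 5 by (simp add: numeral_2_eq_2)
  next
    case 6
    then have occ: "occurs (Suc 0) (pos (n - 2) 1 0 0 0)"
      using occurs_opponent_move[OF start _ two] turn p assms(1) by simp
    then obtain N where "zmove (pos (n - 2) 1 0 0 0) N" and N: "occurs (Suc (Suc 0)) N"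
      using occurs_pos_some_move[OF occ le] by auto
    then consider "occurs (Suc (Suc 0)) (pos (n - 4) (1 + 1) 0 0 0)"
      | "occurs (Suc (Suc 0)) (pos (n - 3) 0 1 0 0)"
      by (auto elim!: zmove_pos_cases)
    then show False
    proof cases
      case 1
      then obtain N where "zmove (pos (n - 4) (1 + 1) 0 0 0) N" and N: "occurs 3 N"
        using occurs_pos_some_move[OF 1 le] by (auto simp: numeral_3_eq_3)
      then show False
        using block[OF N] \<open>r = 5\<close> shiftable_pos assms(2) by (auto elim!: zmove_pos_cases)
    next
      case 2
      then obtain N where "zmove (pos (n - 3) 0 1 0 0) N" and N: "occurs 3 N"
        using occurs_pos_some_move[OF 2 le] by (auto simp: numeral_3_eq_3)
      then show False
        using block[OF N] \<open>r = 5\<close> shiftable_pos assms(2) by (auto elim!: zmove_pos_cases)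
    qed
  qed
qed

end

section \<open>From consecutive players to residues of move numbers\<close>

theorem theorem1p3p2:
  fixes t k n p :: nat and teams :: "nat set set"
  assumes "t \<ge> 3" and "k = t - 1" and "n \<ge> 2 * k\<^sup>2 + 4 * k" and "p = t * k"
    and "partition_on {1..p} teams" and "card teams = t"
    and "\<forall>T\<in>teams. consecutive_players p k T"
  shows "\<not> (\<exists>T\<in>teams. has_winning_strategy n p T)"
proof
  assume "\<exists>T\<in>teams. has_winning_strategy n p T"
  then obtain T where T: "T \<in> teams" "has_winning_strategy n p T" ..
  from T(2) obtain \<sigma> where "winning_team n p T \<sigma>"
    unfolding has_winning_strategy_def by (auto intro: winning_team.intro)
  from T(1) assms(7) obtain s where T: "T = mover p ` {s..<s + k}"
    by (auto simp: consecutive_players_def)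
  have "t = k + 1" using assms(1,2) by simp
  then have k: "2 \<le> k" "p = (k + 1) * k" using assms(1,4) by simp_all
  then have "0 < k * k" by simp
  then have "k < p" using k(2) by simp
  \<comment> \<open>This is \<open>-s\<close> modulo \<open>p\<close>, so that move
    \<open>s\<close>, the first of the team's window, gets residue 0; the outer \<open>mod\<close>
    covers the case that \<open>p\<close> divides \<open>s\<close>.\<close>
  define r where "r = (p - s mod p) mod p"
  have "(s + r) mod p = (s mod p + (p - s mod p)) mod p" by (simp add: r_def mod_simps)
  also have "\<dots> = 0" using \<open>k < p\<close> by simp
  finally have "p dvd s + r" by auto
  then obtain q where q: "s + r = p * q" by (rule dvdE)
  have "mover p m \<in> T \<longleftrightarrow> (m + r) mod p < k" for m
  proof
    assume "mover p m \<in> T"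
    then obtain x where x: "s \<le> x" "x < s + k" "m mod p = x mod p" by (auto simp: T mover_def)
    have "(m + r) mod p = (x + r) mod p" by (rule mod_add_cong) (simp_all add: x(3))
    also have "x + r = x - s + p * q" using x(1) q by simp
    also have "(x - s + p * q) mod p = x - s"
      using x(1,2) \<open>k < p\<close> unfolding mod_mult_self2 by (intro mod_less) linarith
    finally show "(m + r) mod p < k" using x(1,2) by linarith
  next
    assume less: "(m + r) mod p < k"
    \<comment> \<open>Move \<open>s + (m + r) mod p\<close> lies in the window
      \<open>{s..<s + k}\<close> and has the same mover as move \<open>m\<close>.\<close>
    have "(s + (m + r) mod p) mod p = (s + (m + r)) mod p" by (rule mod_add_right_eq)
    also have "s + (m + r) = m + p * q" using q by simp
    finally have "mover p m = mover p (s + (m + r) mod p)" by (simp add: mover_def)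
    then show "mover p m \<in> T" unfolding T using less by (auto intro: imageI)
  qed
  then interpret team_block n p T \<sigma> k r
    using \<open>winning_team n p T \<sigma>\<close> k \<open>k < p\<close>
    unfolding team_block_def team_block_axioms_def by (simp add: r_def)
  show False
  \<comment> \<open>For \<open>k = 2\<close> the bound on \<open>n\<close> is exactly 16.\<close>
  proof (cases "k = 2")
    case True
    then show False using small_block_False assms(3) by simp
  next
    case False
    then show False using large_block_False assms(3) k(1) by simp
  qed
qed

end
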